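(* Let $\alpha>-1$ be real and $q\in\mathbb{N}=\{0,1,2,\dots\}$. Let $(P_n^{\alpha,q})_{n\ge0}$ be the monic polynomials orthogonal on $[-1,1]$ with respect to the signed weight $x^{2q+1}(1-x^2)^{\alpha}(1-x)$, and let $(GG_n^{\alpha,\mu})_{n\ge0}$ be the monic generalized Gegenbauer polynomials, orthogonal on $[-1,1]$ with respect to $|x|^{\mu}(1-x^2)^{\alpha}$. Then for every $n\ge 0$, $$P_{2n}^{\alpha,q}(x)=GG_{2n}^{\alpha,2q+2}(x),$$ $$P_{2n+1}^{\alpha,q}(x)=(1+x)\,GG_{2n}^{\alpha+1,2q+2}(x).$$
   Context: For real $\alpha>-1$ and $q\in\mathbb{N}=\{0,1,2,\dots\}$, let $w_{\alpha,q}(x)=x^{2q+1}(1-x^2)^{\alpha}(1-x)$ on $[-1,1]$ (a weight that changes sign at $0$). $(P_n^{\alpha,q})_{n\ge0}$ denotes the monic orthogonal polynomial sequence for $w_{\alpha,q}$: each $P_n^{\alpha,q}$ is a monic polynomial of degree exactly $n$, $\int_{-1}^1 w_{\alpha,q}(x)x^kP_n^{\alpha,q}(x)\,dx=0$ for $0\le k\le n-1$, and $\int_{-1}^1 w_{\alpha,q}(x)x^nP_n^{\alpha,q}(x)\,dx\ne 0$. For real $\alpha>-1$, $\mu>-1$, $(GG_n^{\alpha,\mu})_{n\ge 0}$ denotes the monic generalized Gegenbauer polynomials: $GG_n^{\alpha,\mu}$ is the monic polynomial of degree $n$ with $\int_{-1}^1|x|^{\mu}(1-x^2)^{\alpha}x^kGG_n^{\alpha,\mu}(x)\,dx=0$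 for $0\le k\le n-1$. *)

theory Defs
  imports "HOL-Analysis.Analysis" "HOL-Computational_Algebra.Polynomial"
begin

text \<open>
  The weights below are only meant almost everywhere: since \<open>0 powr a = 0\<close> in HOL for every \<open>a\<close>,
  their values at \<open>-1\<close>, \<open>0\<close> and \<open>1\<close> can differ from the usual conventions, which does not
  affect the integrals.  For \<open>\<alpha> > -1\<close> and \<open>\<mu> > -1\<close> every integral occurring here converges
  absolutely, so the default value 0 of the integral of a non-integrable function plays no role.
\<close>

definition signed_weight :: "real \<Rightarrow> nat \<Rightarrow> real \<Rightarrow> real" where
  "signed_weight \<alpha> q x = x ^ (2 * q + 1) * (1 - x\<^sup>2) powr \<alpha> * (1 - x)"

definition gen_gegenbauer_weight :: "real \<Rightarrow> real \<Rightarrow> real \<Rightarrow> real" where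
  "gen_gegenbauer_weight \<alpha> \<mu> x = \<bar>x\<bar> powr \<mu> * (1 - x\<^sup>2) powr \<alpha>"

definition monic_orthogonal_poly :: "(real \<Rightarrow> real) \<Rightarrow> nat \<Rightarrow> real poly \<Rightarrow> bool" where
  "monic_orthogonal_poly w n p \<longleftrightarrow>
     degree p = n \<and> lead_coeff p = 1 \<and>
     (\<forall>k<n. integral {-1..1} (\<lambda>x. w x * x ^ k * poly p x) = 0)"

text \<open>
  For a weight that changes sign, the second conjunct does not follow from the first.
\<close>

definition monic_OPS :: "(real \<Rightarrow> real) \<Rightarrow> (nat \<Rightarrow> real poly) \<Rightarrow> bool" where
  "monic_OPS w P \<longleftrightarrow>
     (\<forall>n. monic_orthogonal_poly w n (P n) \<and>
          integral {-1..1} (\<lambda>x. w x * x ^ n * poly (P n) x) \<noteq> 0)"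

end

theory Submission
  imports Defs
begin

text \<open>
  The factor \<open>x^(2q+1) (1 - x)\<close> of the signed weight is the difference of the odd power
  \<open>x^(2q+1)\<close> and the even power \<open>x^(2q+2)\<close>, and everything else in the integrals has a parity:
  \<open>(1 - x\<^sup>2)^\<alpha>\<close> is even, and \<open>G = GG\<^sub>2\<^sub>n\<close> is even because a positive even weight determines
  its monic orthogonal polynomial uniquely, so that the reflection of \<open>G\<close> must be \<open>G\<close>
  (\<open>monic_orthogonal_poly_even\<close>).  So only one of the two powers survives against \<open>x^k G\<close>:
  the even one for even \<open>k\<close>, the odd one for odd \<open>k\<close>, and in both cases what remains is
  \<open>\<plusminus>\<integral> x^(2q+2) (1 - x\<^sup>2)^\<alpha> x^j G\<close> with \<open>j \<le> k\<close> even, a vanishing moment of \<open>G\<close>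
  (\<open>signed_even_degree\<close>).

  In odd degree the factor \<open>1 + x\<close> completes \<open>1 - x\<close> to \<open>1 - x\<^sup>2\<close>, which raises the exponent to
  \<open>\<alpha> + 1\<close>; only \<open>x^(2q+1)\<close> is left, and the same parity argument applies
  (\<open>signed_odd_degree\<close>).  For even \<open>k\<close> the integrand is odd, which is why the orthogonality now
  reaches one degree further, up to \<open>k = 2n\<close>.

  Thus the right-hand sides are monic and orthogonal, with respect to the signed weight, to all
  lower powers.  For a weight that changes sign this does not determine a polynomial by itself;
  the existence of an orthogonal sequence with \<open>\<integral> w x^n P\<^sub>n \<noteq> 0\<close> for all \<open>n\<close> makes it do so
  (\<open>monic_OPS_unique\<close>).
\<close>

section \<open>Integrability\<close>

definition has_moments :: "(real \<Rightarrow> real) \<Rightarrow> bool" where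
  "has_moments w \<longleftrightarrow> (\<forall>p. (\<lambda>x. w x * poly p x) integrable_on {-1..1})"

lemma has_moments_times_poly:
  assumes "has_moments w" and "\<And>x. v x = poly r x * w x"
  shows "has_moments v"
  unfolding has_moments_def
proof
  fix p
  have "(\<lambda>x. w x * poly (r * p) x) integrable_on {-1..1}"
    using assms(1) unfolding has_moments_def by blast
  then show "(\<lambda>x. v x * poly p x) integrable_on {-1..1}"
    by (simp add: assms(2) mult_ac)
qed

text \<open>
  The substitution \<open>t = (1 + x) / 2\<close> turns the weight into the integrand of the Beta function.
  As the weight is nonnegative, it is even absolutely integrable, and may be multiplied by a
  function that is continuous on the closed interval.
\<close>
lemma has_moments_ultraspherical:
  fixes \<beta> :: real
  assumes "\<beta> > -1"
  shows "has_moments (\<lambda>x. (1 - x\<^sup>2) powr \<beta>)"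
  unfolding has_moments_def
proof
  fix p :: "real poly"
  let ?f = "\<lambda>t::real. t powr \<beta> * (1 - t) powr \<beta>"
  have "(?f has_integral Beta (\<beta> + 1) (\<beta> + 1)) (cbox 0 1)"
    using has_integral_Beta_real[of "\<beta> + 1" "\<beta> + 1"] assms by simp
  from has_integral_affinity'[OF this, of "1/2" "1/2"]
  have "(\<lambda>x. ?f (x / 2 + 1 / 2)) integrable_on {-1..1}"
    by (auto simp: integrable_on_def)
  then have "(\<lambda>x. 4 powr \<beta> * ?f (x / 2 + 1 / 2)) integrable_on {-1..1}"
    by (rule integrable_on_mult_right)
  moreover have "4 powr \<beta> * ?f (x / 2 + 1 / 2) = (1 - x\<^sup>2) powr \<beta>" if "x \<in> {-1..1}" for x :: real
  proof -
    have "4 powr \<beta> * ?f (x / 2 + 1 / 2) =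
      (4 * ((x / 2 + 1 / 2) * (1 - (x / 2 + 1 / 2)))) powr \<beta>"
      using that by (simp add: powr_mult)
    also have "4 * ((x / 2 + 1 / 2) * (1 - (x / 2 + 1 / 2))) = 1 - x\<^sup>2"
      by (simp add: field_simps power2_eq_square)
    finally show ?thesis .
  qed
  ultimately have "(\<lambda>x::real. (1 - x\<^sup>2) powr \<beta>) integrable_on {-1..1}"
    by (rule integrable_eq)
  then have "(\<lambda>x::real. (1 - x\<^sup>2) powr \<beta>) absolutely_integrable_on {-1..1}"
    by (rule nonnegative_absolutely_integrable_1) simp
  moreover have "continuous_on {-1..1} (poly p)"
    by (intro continuous_intros)
  ultimately have "(\<lambda>x. poly p x * (1 - x\<^sup>2) powr \<beta>) absolutely_integrable_on {-1..1}"
    by (intro absolutely_integrable_bounded_measurable_product_real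
          continuous_imp_measurable_on_sets_lebesgue compact_imp_bounded
          compact_continuous_image) auto
  then show "(\<lambda>x. (1 - x\<^sup>2) powr \<beta> * poly p x) integrable_on {-1..1}"
    by (simp add: absolutely_integrable_on_def mult.commute)
qed

text \<open>
  The exponent \<open>2q + 2\<close> is even, which makes the absolute value disappear, and positive, which
  makes the identity hold at \<open>0\<close> too.
\<close>
lemma gen_gegenbauer_weight_eq:
  "gen_gegenbauer_weight \<beta> (2 * real q + 2) x = x ^ (2 * q + 2) * (1 - x\<^sup>2) powr \<beta>"
proof -
  have "\<bar>x\<bar> powr real (2 * q + 2) = \<bar>x\<bar> ^ (2 * q + 2)"
    by (rule powr_realpow') auto
  moreover have "\<bar>x\<bar> ^ (2 * q + 2) = x ^ (2 * q + 2)"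
    by (rule power_even_abs) simp
  ultimately show ?thesis
    by (simp add: gen_gegenbauer_weight_def add.commute)
qed

lemma has_moments_gen_gegenbauer:
  assumes "\<beta> > -1"
  shows "has_moments (gen_gegenbauer_weight \<beta> (2 * real q + 2))"
  by (rule has_moments_times_poly[OF has_moments_ultraspherical[OF assms], of _ "monom 1 (2 * q + 2)"])
    (simp only: gen_gegenbauer_weight_eq poly_monom mult_1)

lemma has_moments_signed:
  assumes "\<alpha> > -1"
  shows "has_moments (signed_weight \<alpha> q)"
  by (rule has_moments_times_poly[OF has_moments_ultraspherical[OF assms],
        of _ "monom 1 (2 * q + 1) * [:1, -1:]"])
    (simp add: signed_weight_def poly_monom algebra_simps)

section \<open>Uniqueness of monic orthogonal polynomials\<close>

lemma integral_times_poly: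
  assumes "has_moments w"
  shows "integral {-1..1} (\<lambda>x. w x * poly r x * poly p x) =
    (\<Sum>i\<le>degree r. coeff r i * integral {-1..1} (\<lambda>x. w x * x ^ i * poly p x))"
proof -
  have int: "(\<lambda>x. w x * x ^ i * poly p x) integrable_on {-1..1}" for i
    using assms[unfolded has_moments_def, rule_format, of "monom 1 i * p"]
    by (simp add: poly_monom mult_ac)
  have "integral {-1..1} (\<lambda>x. w x * poly r x * poly p x) =
    integral {-1..1} (\<lambda>x. \<Sum>i\<le>degree r. coeff r i * (w x * x ^ i * poly p x))"
    by (simp add: poly_altdef[of r] sum_distrib_left sum_distrib_right mult_ac)
  also have "\<dots> = (\<Sum>i\<le>degree r. integral {-1..1} (\<lambda>x. coeff r i * (w x * x ^ i * poly p x)))"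
    by (intro integral_sum integrable_on_mult_right int) auto
  finally show ?thesis by simp
qed

text \<open>
  The leading terms cancel, and the orthogonality relations are linear.  Both uniqueness results
  below derive a contradiction from such a difference.
\<close>
lemma monic_orthogonal_poly_diff:
  assumes w: "has_moments w"
    and p: "monic_orthogonal_poly w n p" and r: "monic_orthogonal_poly w n r"
    and ne: "p \<noteq> r"
  shows "degree (p - r) < n"
    and "k < n \<Longrightarrow> integral {-1..1} (\<lambda>x. w x * x ^ k * poly (p - r) x) = 0"
proof -
  have "degree (p - r) \<le> n"
    using p r by (intro degree_diff_le) (auto simp: monic_orthogonal_poly_def)
  moreover have "degree (p - r) \<noteq> n"
  proof
    assume deg: "degree (p - r) = n"
    moreover have "coeff p n = 1" "coeff r n = 1"
      using p r by (auto simp: monic_orthogonal_poly_def)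
    ultimately have "lead_coeff (p - r) = 0"
      by simp
    then show False using ne by (metis leading_coeff_0_iff right_minus_eq)
  qed
  ultimately show "degree (p - r) < n" by simp
next
  assume k: "k < n"
  have "(\<lambda>x. w x * x ^ k * poly s x) integrable_on {-1..1}" for s
    using w[unfolded has_moments_def, rule_format, of "monom 1 k * s"]
    by (simp add: poly_monom mult_ac)
  then show "integral {-1..1} (\<lambda>x. w x * x ^ k * poly (p - r) x) = 0"
    using p r k unfolding monic_orthogonal_poly_def
    by (simp add: right_diff_distrib integral_diff)
qed

text \<open>
  Let \<open>D\<close> be the difference of two candidates and \<open>m < n\<close> its degree.  Evaluate
  \<open>\<integral> w D P\<^sub>m\<close> twice: expanding \<open>D\<close> leaves the leading coefficient of \<open>D\<close> times
  \<open>\<integral> w x^m P\<^sub>m \<noteq> 0\<close>, while expanding \<open>P\<^sub>m\<close> gives \<open>0\<close>, as \<open>D\<close> is orthogonal to all powers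
  below \<open>n\<close>.
\<close>
lemma monic_OPS_unique:
  assumes w: "has_moments w" and P: "monic_OPS w P" and r: "monic_orthogonal_poly w n r"
  shows "P n = r"
proof (rule ccontr)
  assume ne: "P n \<noteq> r"
  define D where "D = P n - r"
  define m where "m = degree D"
  have "coeff D m \<noteq> 0"
    using ne by (simp only: m_def leading_coeff_0_iff) (simp add: D_def)
  have Pn: "monic_orthogonal_poly w n (P n)"
    using P by (simp add: monic_OPS_def)
  have m: "m < n" and
    D: "\<And>k. k < n \<Longrightarrow> integral {-1..1} (\<lambda>x. w x * x ^ k * poly D x) = 0"
    using monic_orthogonal_poly_diff[OF w Pn r ne] by (auto simp: D_def m_def)
  have Pm: "degree (P m) = m"
    "\<And>k. k < m \<Longrightarrow> integral {-1..1} (\<lambda>x. w x * x ^ k * poly (P m) x) = 0"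
    "integral {-1..1} (\<lambda>x. w x * x ^ m * poly (P m) x) \<noteq> 0"
    using P by (auto simp: monic_OPS_def monic_orthogonal_poly_def)
  have "integral {-1..1} (\<lambda>x. w x * poly D x * poly (P m) x) =
      (\<Sum>i\<le>m. coeff D i * integral {-1..1} (\<lambda>x. w x * x ^ i * poly (P m) x))"
    unfolding m_def by (rule integral_times_poly[OF w])
  also have "\<dots> = (\<Sum>i\<in>{m}. coeff D i * integral {-1..1} (\<lambda>x. w x * x ^ i * poly (P m) x))"
    by (rule sum.mono_neutral_right) (auto simp: Pm(2))
  also have "\<dots> \<noteq> 0"
    using Pm(3) \<open>coeff D m \<noteq> 0\<close> by simp
  finally have "integral {-1..1} (\<lambda>x. w x * poly D x * poly (P m) x) \<noteq> 0" .
  moreover have "integral {-1..1} (\<lambda>x. w x * poly (P m) x * poly D x) = 0"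
    using D m by (simp add: integral_times_poly[OF w] Pm(1))
  ultimately show False by (simp add: mult_ac)
qed

text \<open>
  For a nonnegative weight the difference \<open>D\<close> of two candidates satisfies \<open>\<integral> w D\<^sup>2 = 0\<close>.  If the
  weight is continuous and positive on some interval, \<open>D\<close> vanishes there, and so has infinitely
  many roots.
\<close>
lemma monic_orthogonal_poly_unique:
  assumes w: "has_moments w" and nonneg: "\<And>x. w x \<ge> 0"
    and ab: "-1 \<le> a" "a < b" "b \<le> 1"
    and cont: "continuous_on {a..b} w" and pos: "\<And>x. x \<in> {a..b} \<Longrightarrow> w x > 0"
    and p: "monic_orthogonal_poly w n p" and r: "monic_orthogonal_poly w n r"
  shows "p = r"
proof (rule ccontr)
  assume ne: "p \<noteq> r"
  define D where "D = p - r"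
  have deg: "degree D < n" and
    D: "\<And>k. k < n \<Longrightarrow> integral {-1..1} (\<lambda>x. w x * x ^ k * poly D x) = 0"
    using monic_orthogonal_poly_diff[OF w p r ne] by (auto simp: D_def)
  let ?f = "\<lambda>x. w x * poly D x * poly D x"
  have f_nonneg: "?f x \<ge> 0" for x
    using nonneg[of x] by (simp add: mult.assoc)
  have f_cont: "continuous_on {a..b} ?f"
    by (intro continuous_intros cont)
  have "?f integrable_on {-1..1}"
    using w[unfolded has_moments_def, rule_format, of "D * D"] by (simp add: mult.assoc)
  then have "integral {a..b} ?f \<le> integral {-1..1} ?f"
    using ab f_nonneg integrable_continuous_real[OF f_cont] by (intro integral_subset_le) auto
  also have "\<dots> = 0"
    using D deg by (simp add: integral_times_poly[OF w])
  finally have "integral {a..b} ?f = 0"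
    using f_nonneg integrable_continuous_real[OF f_cont] by (intro antisym integral_nonneg) auto
  then have "\<forall>x\<in>{a..b}. ?f x = 0"
    using integral_eq_0_iff[OF f_cont \<open>a < b\<close>] f_nonneg by blast
  then have "{a..b} \<subseteq> {x. poly D x = 0}"
    using pos by fastforce
  moreover have "finite {x. poly D x = 0}"
    using ne by (intro poly_roots_finite) (simp add: D_def)
  ultimately have "finite {a..b}"
    by (rule finite_subset)
  then show False
    using \<open>a < b\<close> by (simp add: infinite_Icc)
qed

section \<open>Parity\<close>

lemma integral_odd_eq_0:
  fixes f :: "real \<Rightarrow> real"
  assumes "\<And>x. f (-x) = - f x"
  shows "integral {-a..a} f = 0"
proof -
  have "integral {-a..a} f = integral {-a..a} (\<lambda>x. f (-x))"
    using Henstock_Kurzweil_Integration.integral_reflect_real[of a "-a" f]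
    by (simp only: minus_minus)
  then show ?thesis
    by (simp add: assms)
qed

text \<open>
  The reflection \<open>p (-x)\<close> is orthogonal because the weight is even, and monic because its leading
  coefficient is \<open>(-1)^(2n)\<close>; by uniqueness it is \<open>p\<close>.
\<close>
lemma monic_orthogonal_poly_even:
  assumes w: "has_moments w" and nonneg: "\<And>x. w x \<ge> 0"
    and ab: "-1 \<le> a" "a < b" "b \<le> 1"
    and cont: "continuous_on {a..b} w" and pos: "\<And>x. x \<in> {a..b} \<Longrightarrow> w x > 0"
    and even: "\<And>x. w (-x) = w x"
    and p: "monic_orthogonal_poly w (2 * n) p"
  shows "poly p (-x) = poly p x"
proof -
  define r where "r = p \<circ>\<^sub>p [:0, -1:]"
  have r: "poly r x = poly p (-x)" for x
    by (simp add: r_def poly_pcompose)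
  have "monic_orthogonal_poly w (2 * n) r"
    unfolding monic_orthogonal_poly_def
  proof (intro conjI allI impI)
    have "degree p = 2 * n" "lead_coeff p = 1"
      using p by (auto simp: monic_orthogonal_poly_def)
    moreover have "lead_coeff r = lead_coeff p * (-1) ^ degree p"
      unfolding r_def by (subst lead_coeff_comp) auto
    ultimately show "degree r = 2 * n" "lead_coeff r = 1"
      by (simp_all add: r_def degree_pcompose)
    fix k assume "k < 2 * n"
    have "integral {-1..1} (\<lambda>x. w x * x ^ k * poly r x) =
        integral {-1..1} (\<lambda>x. w (-x) * (-x) ^ k * poly r (-x))"
      using Henstock_Kurzweil_Integration.integral_reflect_real
        [of 1 "-1" "\<lambda>x. w x * x ^ k * poly r x"] by (simp only: minus_minus)
    also have "\<dots> = integral {-1..1} (\<lambda>x. (-1) ^ k * (w x * x ^ k * poly p x))"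
    proof (rule integral_cong)
      fix x :: real
      show "w (-x) * (-x) ^ k * poly r (-x) = (-1) ^ k * (w x * x ^ k * poly p x)"
        by (subst power_minus[of x]) (simp add: r even mult_ac)
    qed
    also have "\<dots> = 0"
      using p \<open>k < 2 * n\<close> by (simp add: monic_orthogonal_poly_def)
    finally show "integral {-1..1} (\<lambda>x. w x * x ^ k * poly r x) = 0" .
  qed
  then have "p = r"
    using monic_orthogonal_poly_unique[OF w nonneg ab cont pos p] by blast
  then show ?thesis
    using r[of x] by simp
qed

lemma gen_gegenbauer_even:
  assumes \<beta>: "\<beta> > -1"
    and G: "monic_orthogonal_poly (gen_gegenbauer_weight \<beta> (2 * real q + 2)) (2 * n) G"
  shows "poly G (-x) = poly G x"
proof (rule monic_orthogonal_poly_even[OF has_moments_gen_gegenbauer[OF \<beta>] _ _ _ _ _ _ _ G,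
      where a = "1/4" and b = "1/2"])
  \<comment> \<open>Any closed interval inside \<open>(0, 1)\<close> would do: the weight can vanish or be discontinuous only
    at \<open>-1\<close>, \<open>0\<close> and \<open>1\<close>.\<close>
  have sq: "0 < 1 - x\<^sup>2" if "x \<in> {1/4..1/2}" for x :: real
    using that power_strict_mono[of x 1 2] by simp
  show "continuous_on {1/4..1/2} (gen_gegenbauer_weight \<beta> (2 * real q + 2))"
    unfolding gen_gegenbauer_weight_eq[abs_def]
    by (intro continuous_intros) (use sq in force)
  show "gen_gegenbauer_weight \<beta> (2 * real q + 2) x > 0" if "x \<in> {1/4..1/2}" for x
    using that sq[OF that] by (simp add: gen_gegenbauer_weight_def)
qed (simp_all add: gen_gegenbauer_weight_def)

section \<open>Orthogonality for the signed weight\<close>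

text \<open>
  The odd moments of \<open>x^(2q+1) (1 - x\<^sup>2)^\<beta> G\<close> are lower even moments for \<open>x^(2q+2) (1 - x\<^sup>2)^\<beta> G\<close>;
  the even ones vanish by symmetry.
\<close>
lemma odd_power_moment_eq_0:
  assumes \<beta>: "\<beta> > -1"
    and G: "monic_orthogonal_poly (gen_gegenbauer_weight \<beta> (2 * real q + 2)) (2 * n) G"
    and k: "k \<le> 2 * n"
  shows "integral {-1..1} (\<lambda>x. x ^ (2 * q + 1) * (1 - x\<^sup>2) powr \<beta> * x ^ k * poly G x) = 0"
proof (cases "even k")
  case True
  then show ?thesis
    by (intro integral_odd_eq_0)
      (simp add: gen_gegenbauer_even[OF \<beta> G] power_minus_even)
next
  case False
  then obtain j where j: "k = Suc j"
    by (cases k) auto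
  have "integral {-1..1} (\<lambda>x. gen_gegenbauer_weight \<beta> (2 * real q + 2) x * x ^ j * poly G x) = 0"
    using G k j by (simp add: monic_orthogonal_poly_def)
  then show ?thesis
    unfolding j gen_gegenbauer_weight_eq by (simp add: mult_ac)
qed

lemma signed_even_degree:
  assumes \<alpha>: "\<alpha> > -1"
    and G: "monic_orthogonal_poly (gen_gegenbauer_weight \<alpha> (2 * real q + 2)) (2 * n) G"
  shows "monic_orthogonal_poly (signed_weight \<alpha> q) (2 * n) G"
  unfolding monic_orthogonal_poly_def
proof (intro conjI allI impI)
  show "degree G = 2 * n" "lead_coeff G = 1"
    using G by (auto simp: monic_orthogonal_poly_def)
  fix k assume k: "k < 2 * n"
  let ?u = "\<lambda>i x. (1 - x\<^sup>2) powr \<alpha> * x ^ i * poly G x"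
  have int: "?u i integrable_on {-1..1}" for i
    using has_moments_ultraspherical[OF \<alpha>, unfolded has_moments_def, rule_format, of "monom 1 i * G"]
    by (simp add: poly_monom mult_ac)
  have "integral {-1..1} (\<lambda>x. signed_weight \<alpha> q x * x ^ k * poly G x) =
      integral {-1..1} (\<lambda>x. ?u (2 * q + 1 + k) x - ?u (2 * q + 2 + k) x)"
    by (simp add: signed_weight_def algebra_simps power_add)
  also have "\<dots> = integral {-1..1} (?u (2 * q + 1 + k)) - integral {-1..1} (?u (2 * q + 2 + k))"
    by (intro integral_diff int)
  also have "integral {-1..1} (?u (2 * q + 1 + k)) = 0"
    using odd_power_moment_eq_0[OF \<alpha> G, of k] k by (simp add: power_add mult_ac)
  also have "integral {-1..1} (?u (2 * q + 2 + k)) =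
      integral {-1..1} (\<lambda>x. gen_gegenbauer_weight \<alpha> (2 * real q + 2) x * x ^ k * poly G x)"
    unfolding gen_gegenbauer_weight_eq by (simp add: power_add mult_ac)
  also have "\<dots> = 0"
    using G k by (simp add: monic_orthogonal_poly_def)
  finally show "integral {-1..1} (\<lambda>x. signed_weight \<alpha> q x * x ^ k * poly G x) = 0"
    by simp
qed

lemma signed_odd_degree:
  assumes \<alpha>: "\<alpha> > -1"
    and G: "monic_orthogonal_poly (gen_gegenbauer_weight (\<alpha> + 1) (2 * real q + 2)) (2 * n) G"
  shows "monic_orthogonal_poly (signed_weight \<alpha> q) (2 * n + 1) ([:1, 1:] * G)"
  unfolding monic_orthogonal_poly_def
proof (intro conjI allI impI)
  have "G \<noteq> 0" "degree G = 2 * n" "lead_coeff G = 1"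
    using G by (auto simp: monic_orthogonal_poly_def)
  then show "degree ([:1, 1:] * G) = 2 * n + 1" "lead_coeff ([:1, 1:] * G) = 1"
    by (simp add: degree_mult_eq del: mult_pCons_left)
      (simp only: lead_coeff_mult \<open>lead_coeff G = 1\<close>, simp)
  fix k assume k: "k < 2 * n + 1"
  have "signed_weight \<alpha> q x * x ^ k * poly ([:1, 1:] * G) x =
      x ^ (2 * q + 1) * (1 - x\<^sup>2) powr (\<alpha> + 1) * x ^ k * poly G x" if "x \<in> {-1..1}" for x
  proof -
    have "0 \<le> 1 - x\<^sup>2"
      using that by (simp add: abs_square_le_1 abs_le_iff)
    then have "(1 - x\<^sup>2) powr (\<alpha> + 1) = (1 - x\<^sup>2) powr \<alpha> * ((1 - x) * (1 + x))"
      by (simp add: powr_add power2_eq_square algebra_simps)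
    moreover have "poly ([:1, 1:] * G) x = (1 + x) * poly G x"
      by (simp add: algebra_simps)
    ultimately show ?thesis
      by (simp only: signed_weight_def mult_ac)
  qed
  then have "integral {-1..1} (\<lambda>x. signed_weight \<alpha> q x * x ^ k * poly ([:1, 1:] * G) x) =
      integral {-1..1} (\<lambda>x. x ^ (2 * q + 1) * (1 - x\<^sup>2) powr (\<alpha> + 1) * x ^ k * poly G x)"
    by (rule integral_cong)
  also have "\<dots> = 0"
    using odd_power_moment_eq_0[OF _ G, of k] \<alpha> k by simp
  finally show "integral {-1..1} (\<lambda>x. signed_weight \<alpha> q x * x ^ k * poly ([:1, 1:] * G) x) = 0" .
qed

theorem proposition3p1:
  fixes \<alpha> :: real and q :: nat
    and P :: "nat \<Rightarrow> real poly"
    and GG :: "real \<Rightarrow> real \<Rightarrow> nat \<Rightarrow> real poly"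
  assumes "\<alpha> > -1"
    and "monic_OPS (signed_weight \<alpha> q) P"
    and "\<And>\<beta> \<mu> n. \<beta> > -1 \<Longrightarrow> \<mu> > -1 \<Longrightarrow>
           monic_orthogonal_poly (gen_gegenbauer_weight \<beta> \<mu>) n (GG \<beta> \<mu> n)"
  shows "\<forall>n. P (2 * n) = GG \<alpha> (2 * real q + 2) (2 * n) \<and>
             P (2 * n + 1) = [:1, 1:] * GG (\<alpha> + 1) (2 * real q + 2) (2 * n)"
proof (intro allI conjI)
  fix n
  note unique = monic_OPS_unique[OF has_moments_signed[OF assms(1)] assms(2)]
  show "P (2 * n) = GG \<alpha> (2 * real q + 2) (2 * n)"
    using assms(1) by (intro unique signed_even_degree assms(3)) auto
  show "P (2 * n + 1) = [:1, 1:] * GG (\<alpha> + 1) (2 * real q + 2) (2 * n)"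
    using assms(1) by (intro unique signed_odd_degree assms(3)) auto
qed

end
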